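(* Let $\mathbb{K}$ be a field of characteristic zero, let $f_1(t),f_2(t)$ be delta series over $\mathbb{K}$, and let $(\widetilde s_n^{[2]}(x))_{n\ge0}$ be the 2-iterated associated Sheffer polynomials of $f_1$ and $f_2$. Then the polynomials $\widetilde s_n^{[2]}(x)$ are quasi-monomial with respect to the multiplicative and derivative operators $$\hat M_{\widetilde s^{[2]}}=\frac{x}{f_1'(f_2(\partial_x))\,f_2'(\partial_x)},\qquad \hat P_{\widetilde s^{[2]}}=f_1(f_2(\partial_x)),$$ where $\partial_x=\frac{\partial}{\partial x}$; that is, $\hat M_{\widetilde s^{[2]}}\{\widetilde s_n^{[2]}(x)\}=\widetilde s_{n+1}^{[2]}(x)$ for all $n\ge0$ and $\hat P_{\widetilde s^{[2]}}\{\widetilde s_n^{[2]}(x)\}=n\,\widetilde s_{n-1}^{[2]}(x)$ for all $n\ge1$.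
   Context: A formal power series $f(t)=\sum_{n\ge0}f_nt^n/n!$ over $\mathbb{K}$ is a delta series if $f_0=0$ and $f_1\neq 0$; then $\bar f(t)$ denotes its compositional inverse. The 2-iterated associated Sheffer polynomials of $f_1$ and $f_2$ are determined by $$\exp\bigl(x\,\bar f_2(\bar f_1(t))\bigr)=\sum_{n=0}^\infty \widetilde s_n^{[2]}(x)\frac{t^n}{n!}.$$ For a formal power series $h(t)=\sum_k h_kt^k$, $h(\partial_x)$ denotes the operator $\sum_k h_k\partial_x^k$ on polynomials in $x$ (a finite sum on each polynomial); quotients and compositions of series are formed as formal power series before substituting $\partial_x$, and primes denote formal derivatives. The symbol $x$ denotes the operator of multiplication by $x$; $\frac{x}{h(\partial_x)}$ means $x\cdot\frac{1}{h(\partial_x)}$, with multiplication by $x$ performed last. *)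

theory Defs
  imports "HOL-Computational_Algebra.Computational_Algebra"
begin

(* Series are stored by their ordinary coefficients: for f(t) = sum f_n t^n / n!,
   "fps_nth f n" is f_n / n!.  In degrees 0 and 1 the two normalizations agree. *)
definition delta_series :: "'a::field_char_0 fps \<Rightarrow> bool" where
  "delta_series f \<longleftrightarrow> fps_nth f 0 = 0 \<and> fps_nth f 1 \<noteq> 0"

(* The coefficientwise embedding of K[[t]] into K[x][[t]]. *)
definition fps_const_coeffs :: "'a::field_char_0 fps \<Rightarrow> 'a poly fps" where
  "fps_const_coeffs g = Abs_fps (\<lambda>n. [:fps_nth g n:])"

(* exp(x g(t)) as an element of K[x][[t]]: the series sum t^n / n!, with coefficients
   read in K[x], composed with x g(t).  Meaningful when g has zero constant term. *)
definition exp_x_fps :: "'a::field_char_0 fps \<Rightarrow> 'a poly fps" where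
  "exp_x_fps g = fps_const_coeffs (fps_exp 1) oo (fps_const [:0, 1:] * fps_const_coeffs g)"

definition iterated2_associated_sheffer ::
    "'a::field_char_0 fps \<Rightarrow> 'a fps \<Rightarrow> (nat \<Rightarrow> 'a poly) \<Rightarrow> bool" where
  "iterated2_associated_sheffer f1 f2 s \<longleftrightarrow>
     exp_x_fps (fps_inv f2 oo fps_inv f1) = Abs_fps (\<lambda>n. smult (1 / fact n) (s n))"

(* The generating function determines the sequence. *)
lemma ex1_iterated2_associated_sheffer:
  "\<exists>!s. iterated2_associated_sheffer f1 f2 s"
proof (rule ex1I)
  show "iterated2_associated_sheffer f1 f2
          (\<lambda>n. smult (fact n) (fps_nth (exp_x_fps (fps_inv f2 oo fps_inv f1)) n))"
    by (simp add: iterated2_associated_sheffer_def fps_eq_iff)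
next
  fix s assume "iterated2_associated_sheffer f1 f2 s"
  then show "s = (\<lambda>n. smult (fact n) (fps_nth (exp_x_fps (fps_inv f2 oo fps_inv f1)) n))"
    by (simp add: iterated2_associated_sheffer_def fun_eq_iff)
qed

(* h(d/dx) = sum h_k (d/dx)^k; the terms with k > degree p vanish on p. *)
definition fps_diff_op :: "'a::field_char_0 fps \<Rightarrow> 'a poly \<Rightarrow> 'a poly" where
  "fps_diff_op h p = (\<Sum>k\<le>degree p. smult (fps_nth h k) ((pderiv ^^ k) p))"

definition quasi_monomial ::
    "('a::field_char_0 poly \<Rightarrow> 'a poly) \<Rightarrow> ('a poly \<Rightarrow> 'a poly) \<Rightarrow> (nat \<Rightarrow> 'a poly) \<Rightarrow> bool" where
  "quasi_monomial M P s \<longleftrightarrow>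
     (\<forall>n. M (s n) = s (n + 1)) \<and> (\<forall>n\<ge>1. P (s n) = of_nat n * s (n - 1))"

end

theory Submission
  imports Defs
begin

text \<open>
  Put \<open>F = f1 oo f2\<close>, a delta series, and let \<open>G = fps_inv f2 oo fps_inv f1\<close> be its compositional
  inverse, so that \<open>s n / n!\<close> is the coefficient of \<open>t^n\<close> in \<open>E = exp (x * G(t))\<close>.

  Differentiation with respect to \<open>x\<close> multiplies \<open>E\<close> by \<open>G(t)\<close>; hence \<open>h(d/dx)\<close> multiplies it by
  \<open>h(G(t))\<close>. For \<open>h = F\<close> this factor is \<open>t\<close>, and multiplication by \<open>t\<close> shifts the sequence \<open>s\<close> down
  with the factor \<open>n\<close>. For \<open>h = 1 / F'\<close> the chain rule applied to \<open>F(G(t)) = t\<close> shows that the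
  factor is \<open>G'(t)\<close>; and \<open>x * G'(t) * E\<close> is the derivative of \<open>E\<close> with respect to \<open>t\<close>, which shifts
  \<open>s\<close> up. By the chain rule again, \<open>F'\<close> is the denominator in the multiplicative operator.

  All of this is read off coefficientwise: the coefficient of \<open>x^i t^n\<close> in \<open>E\<close> is that of \<open>t^n\<close> in
  \<open>G^i / i!\<close> (\<open>coeff_exp_x_fps\<close>), and in \<open>h(d/dx) E\<close> it is that of \<open>t^n\<close> in \<open>h(G) * G^i / i!\<close>
  (\<open>coeff_fps_diff_op_exp_x_fps\<close>).
\<close>

lemma fps_const_coeffs_mult:
  "fps_const_coeffs (f * g) = fps_const_coeffs f * fps_const_coeffs g"
proof (rule fps_ext)
  fix n
  have "[:\<Sum>i\<in>A. fps_nth f i * fps_nth g (n - i):] = (\<Sum>i\<in>A. [:fps_nth f i:] * [:fps_nth g (n - i):])"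
    for A :: "nat set"
    by (rule poly_eqI) (auto simp: coeff_sum coeff_pCons mult.commute split: nat.split)
  then show "fps_nth (fps_const_coeffs (f * g)) n
      = fps_nth (fps_const_coeffs f * fps_const_coeffs g) n"
    by (simp add: fps_const_coeffs_def fps_mult_nth)
qed

lemma fps_const_coeffs_power: "fps_const_coeffs (g ^ i) = fps_const_coeffs g ^ i"
proof (induction i)
  case 0
  show ?case
    by (simp add: fps_const_coeffs_def fps_eq_iff)
next
  case (Suc i)
  then show ?case
    by (simp add: fps_const_coeffs_mult)
qed

text \<open>
  The truncation \<open>i \<le> n\<close> built into composition leaves no trace in the formula, because \<open>t^i\<close>
  divides \<open>g^i\<close>.
\<close>
lemma coeff_exp_x_fps:
  assumes "fps_nth g 0 = 0"
  shows "coeff (fps_nth (exp_x_fps g) n) i = fps_nth (g ^ i) n / fact i"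
proof -
  have X_power: "[:0, 1:] ^ j = monom (1::'a) j" for j
    by (simp add: monom_altdef)
  have "fps_nth (exp_x_fps g) n = (\<Sum>j=0..n. monom (fps_nth (g ^ j) n / fact j) j)"
    by (simp add: exp_x_fps_def fps_compose_nth power_mult_distrib fps_const_power X_power
        flip: fps_const_coeffs_power)
       (simp add: fps_const_coeffs_def smult_monom mult.commute)
  then have "coeff (fps_nth (exp_x_fps g) n) i = (if i \<le> n then fps_nth (g ^ i) n / fact i else 0)"
    by (simp add: coeff_sum)
  then show ?thesis
    using startsby_zero_power_prefix[OF assms] by auto
qed

lemma degree_exp_x_fps_le:
  assumes "fps_nth g 0 = 0"
  shows "degree (fps_nth (exp_x_fps g) n) \<le> n"
  using startsby_zero_power_prefix[OF assms] by (intro degree_le) (simp add: coeff_exp_x_fps[OF assms])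

text \<open>A summation range that can be chosen independently of \<open>p\<close> makes the operator visibly linear.\<close>
lemma fps_diff_op_eq_sum:
  assumes "degree p \<le> N"
  shows "fps_diff_op h p = (\<Sum>k\<le>N. smult (fps_nth h k) ((pderiv ^^ k) p))"
proof -
  have "(pderiv ^^ k) p = 0" if "degree p < k" for k
    using that by (intro poly_eqI) (simp add: coeff_higher_pderiv coeff_eq_0)
  then show ?thesis
    unfolding fps_diff_op_def using assms by (intro sum.mono_neutral_left) auto
qed

lemma fps_compose_mult_power_nth:
  fixes h g :: "'a::field_char_0 fps"
  assumes "fps_nth g 0 = 0"
  shows "fps_nth ((h oo g) * g ^ i) n = (\<Sum>k\<le>n. fps_nth h k * fps_nth (g ^ (i + k)) n)"
proof -
  have "(h oo g) * g ^ i = (h * fps_X ^ i) oo g"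
    using assms
    by (simp add: fps_compose_mult_distrib fps_compose_power[OF assms, symmetric]
        fps_X_fps_compose_startby0)
  then have "fps_nth ((h oo g) * g ^ i) n
      = (\<Sum>j=0..n. fps_nth (h * fps_X ^ i) j * fps_nth (g ^ j) n)"
    by (simp add: fps_compose_nth)
  \<comment> \<open>Terms with \<open>j < i\<close> vanish by the factor \<open>t^i\<close>, those with \<open>j > n\<close> because \<open>t^j\<close> divides \<open>g^j\<close>.\<close>
  also have "\<dots> = (\<Sum>j=0+i..n+i. fps_nth (h * fps_X ^ i) j * fps_nth (g ^ j) n)"
    using startsby_zero_power_prefix[OF assms]
    by (intro sum.mono_neutral_cong) (auto simp: fps_X_power_mult_right_nth)
  also have "\<dots> = (\<Sum>k=0..n. fps_nth h k * fps_nth (g ^ (i + k)) n)"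
    unfolding sum.shift_bounds_cl_nat_ivl by (simp add: fps_X_power_mult_right_nth add.commute)
  finally show ?thesis
    by (simp add: atLeast0AtMost)
qed

text \<open>
  The coefficient form of \<open>h(d/dx) exp (x * g(t)) = h(g(t)) * exp (x * g(t))\<close>. Applying \<open>(d/dx)^k\<close>
  turns \<open>x^(i + k) / (i + k)!\<close> into \<open>x^i / i!\<close>, so what stands next to \<open>x^i / i!\<close> becomes
  \<open>g^(i + k) = g^k * g^i\<close>.
\<close>
lemma coeff_fps_diff_op_exp_x_fps:
  assumes "fps_nth g 0 = 0"
  shows "coeff (fps_diff_op h (fps_nth (exp_x_fps g) n)) i = fps_nth ((h oo g) * g ^ i) n / fact i"
proof -
  have "pochhammer (of_nat (Suc i)) k / fact (i + k) = (1 / fact i :: 'a)" for k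
  proof -
    have "fact (i + k) = fact i * pochhammer (of_nat (Suc i) :: 'a) k"
      using pochhammer_product[of i "i + k" "1::'a"] by (simp add: pochhammer_fact[symmetric])
    moreover have "fact (i + k) \<noteq> (0::'a)"
      by simp
    ultimately show ?thesis
      by auto
  qed
  then have "pochhammer (of_nat (Suc i)) k * (c / fact (i + k)) = c / (fact i :: 'a)" for k c
    by (metis times_divide_eq_left times_divide_eq_right mult.commute mult.right_neutral)
  then show ?thesis
    by (simp add: fps_diff_op_eq_sum[OF degree_exp_x_fps_le[OF assms]] coeff_sum
        coeff_higher_pderiv coeff_exp_x_fps[OF assms] fps_compose_mult_power_nth[OF assms]
        sum_divide_distrib del: of_nat_Suc)
qed

lemma fps_diff_op_smult: "fps_diff_op h (smult c p) = smult c (fps_diff_op h p)"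
proof -
  have "degree (smult c p) \<le> degree p"
    by (rule degree_smult_le)
  then show ?thesis
    by (intro poly_eqI) (simp add: fps_diff_op_eq_sum[of _ "degree p"] higher_pderiv_smult coeff_sum
        sum_distrib_left ac_simps)
qed

text \<open>If \<open>F(g(t)) = t\<close>, then \<open>F(d/dx)\<close> multiplies \<open>exp (x * g(t))\<close> by \<open>t\<close>.\<close>
lemma fps_diff_op_exp_x_fps_lower:
  assumes "fps_nth g 0 = 0" and "F oo g = fps_X"
  shows "fps_diff_op F (fps_nth (exp_x_fps g) (Suc n)) = fps_nth (exp_x_fps g) n"
  by (rule poly_eqI)
     (simp add: coeff_fps_diff_op_exp_x_fps[OF assms(1)] coeff_exp_x_fps[OF assms(1)] assms(2))

text \<open>
  If \<open>h(g(t)) = g'(t)\<close>, then \<open>x * h(d/dx)\<close> acts on \<open>exp (x * g(t))\<close> as the derivative with respect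
  to \<open>t\<close>; on coefficients this is \<open>(g^(i + 1))' = (i + 1) * g' * g^i\<close>.
\<close>
lemma fps_diff_op_exp_x_fps_raise:
  assumes "fps_nth g 0 = 0" and "h oo g = fps_deriv g"
  shows "[:0, 1:] * fps_diff_op h (fps_nth (exp_x_fps g) n)
         = smult (of_nat (Suc n)) (fps_nth (exp_x_fps g) (Suc n))"
proof (rule poly_eqI)
  fix i
  show "coeff ([:0, 1:] * fps_diff_op h (fps_nth (exp_x_fps g) n)) i
      = coeff (smult (of_nat (Suc n)) (fps_nth (exp_x_fps g) (Suc n))) i"
  proof (cases i)
    case 0
    then show ?thesis
      by (simp add: coeff_exp_x_fps[OF assms(1)])
  next
    case (Suc j)
    have "of_nat (Suc n) * fps_nth (g ^ Suc j) (Suc n) = fps_nth (fps_deriv (g ^ Suc j)) n"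
      by (simp only: fps_deriv_nth Suc_eq_plus1)
    also have "fps_deriv (g ^ Suc j) = fps_const (of_nat (Suc j)) * (fps_deriv g * g ^ j)"
      by (subst fps_deriv_power) (simp add: mult.assoc)
    finally have "of_nat (Suc n) * fps_nth (g ^ Suc j) (Suc n)
        = of_nat (Suc j) * fps_nth (fps_deriv g * g ^ j) n"
      by (simp del: of_nat_Suc)
    then show ?thesis
      by (simp add: Suc coeff_exp_x_fps[OF assms(1)] coeff_fps_diff_op_exp_x_fps[OF assms(1)]
          assms(2) coeff_pCons field_simps del: of_nat_Suc power_Suc)
  qed
qed

lemma fps_inv_nth_0: "fps_nth (fps_inv f) 0 = 0"
  by (simp add: fps_inv_def)

theorem corollary3p1:
  fixes f1 f2 :: "'a::field_char_0 fps" and s :: "nat \<Rightarrow> 'a poly"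
  assumes "delta_series f1" and "delta_series f2"
    and "iterated2_associated_sheffer f1 f2 s"
  shows "quasi_monomial
           (\<lambda>p. [:0, 1:] * fps_diff_op (1 / ((fps_deriv f1 oo f2) * fps_deriv f2)) p)
           (fps_diff_op (f1 oo f2)) s"
proof -
  define F where "F = f1 oo f2"
  define G where "G = fps_inv f2 oo fps_inv f1"
  have f1: "fps_nth f1 0 = 0" "fps_nth f1 1 \<noteq> 0" and f2: "fps_nth f2 0 = 0" "fps_nth f2 1 \<noteq> 0"
    using assms(1,2) by (auto simp: delta_series_def)
  have G0: "fps_nth G 0 = 0"
    by (simp add: G_def fps_inv_nth_0)
  have "f2 oo G = fps_inv f1"
    using f2 by (simp add: G_def fps_compose_assoc fps_inv_nth_0 fps_inv_right)
  then have FG: "F oo G = fps_X"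
    using f1 f2 G0 by (simp add: F_def fps_inv_right flip: fps_compose_assoc)
  have F': "fps_deriv F = (fps_deriv f1 oo f2) * fps_deriv f2"
    using f2 by (simp add: F_def fps_compose_deriv)
  have F'0: "fps_nth (fps_deriv F) 0 \<noteq> 0"
    unfolding F' using f1 f2 by simp
  have inverse_F'_G: "1 / fps_deriv F oo G = fps_deriv G"
  proof -
    have "(fps_deriv F oo G) * fps_deriv G = 1"
      using fps_compose_deriv[OF G0, of F] FG by simp
    then have "inverse (fps_deriv F oo G) = fps_deriv G"
      by (rule fps_inverse_unique)
    then show ?thesis
      using F'0 G0 by (simp add: fps_divide_unit fps_inverse_compose)
  qed
  have s: "s n = smult (fact n) (fps_nth (exp_x_fps G) n)" for n
    using assms(3) by (simp add: iterated2_associated_sheffer_def G_def)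
  show ?thesis
    unfolding quasi_monomial_def
  proof (intro conjI allI impI)
    fix n
    show "[:0, 1:] * fps_diff_op (1 / ((fps_deriv f1 oo f2) * fps_deriv f2)) (s n) = s (n + 1)"
      using fps_diff_op_exp_x_fps_raise[OF G0 inverse_F'_G, of n]
      by (simp add: s fps_diff_op_smult mult_smult_right mult.commute[of "fact n"]
          flip: F'
          del: mult_pCons_left)
  next
    fix n :: nat
    assume "n \<ge> 1"
    then obtain m where "n = Suc m"
      by (cases n) auto
    then show "fps_diff_op (f1 oo f2) (s n) = of_nat n * s (n - 1)"
      using fps_diff_op_exp_x_fps_lower[OF G0 FG, of m]
      by (simp add: s fps_diff_op_smult of_nat_poly mult.commute flip: F_def del: of_nat_Suc)
  qed
qed

end
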